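(* There exists an absolute constant $C>0$ such that, for every nonzero integer $h$, there exists $x_0(h)$ with the property that, for every $x\ge x_0(h)$, $$\sup_{\lambda>0}A_{h,\lambda}(x)\le C\frac{x}{\sqrt{\log\log\log x}},$$ where the supremum is over all real $\lambda>0$. (The constant $C$ is independent of $h$ and $\lambda$; only the threshold $x_0(h)$ may depend on $h$, and it does not depend on $\lambda$.) Consequently, for every fixed integer $h\ne0$, $$\sup_{\lambda>0}\frac{A_{h,\lambda}(x)}{x}\longrightarrow0\qquad(x\to\infty).$$
   Context: $\mathbb N=\{1,2,\ldots\}$; $\sigma(n)=\sum_{d\mid n}d$. For a nonzero integer $h$ and real $\lambda>0$, $$A_{h,\lambda}(x)=\#\{n\in\mathbb N: n\le x,\ n+h\ge1,\ \sigma(n+h)=\lambda\sigma(n)\}.$$ *)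

theory Defs
  imports Complex_Main
begin

definition divisor_sum :: "nat \<Rightarrow> nat" where
  "divisor_sum n = (\<Sum>d | d dvd n. d)"

definition A_set :: "int \<Rightarrow> real \<Rightarrow> real \<Rightarrow> nat set" where
  "A_set h l x = {n. n \<ge> 1 \<and> real n \<le> x \<and> int n + h \<ge> 1 \<and>
     real (divisor_sum (nat (int n + h))) = l * real (divisor_sum n)}"

definition A_count :: "int \<Rightarrow> real \<Rightarrow> real \<Rightarrow> nat" where
  "A_count h l x = card (A_set h l x)"

text \<open>The next two lemmas show that neither \<open>card\<close> nor the real-valued supremum over \<open>l\<close>
  is ever applied outside its intended domain.\<close>

lemma A_set_subset: "A_set h l x \<subseteq> {1..nat \<lfloor>x\<rfloor>}"
  by (auto simp: A_set_def le_nat_floor)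

lemma finite_A_set: "finite (A_set h l x)"
  by (rule finite_subset[OF A_set_subset]) simp

lemma bdd_above_A_count: "bdd_above ((\<lambda>l. real (A_count h l x)) ` {0<..})"
proof (rule bdd_aboveI2)
  fix l :: real
  show "real (A_count h l x) \<le> real (nat \<lfloor>x\<rfloor>)"
    unfolding A_count_def using card_mono[OF _ A_set_subset[of h l x]] by simp
qed

end

theory Submission
  imports Defs "HOL-Number_Theory.Number_Theory" "HOL-Analysis.Harmonic_Numbers"
    "HOL-Real_Asymp.Real_Asymp"
begin

text \<open>
  Write \<open>g n = \<sigma>(n) / n\<close>, the sum of \<open>1 / d\<close> over \<open>d dvd n\<close>. Put \<open>T = D!\<close> with \<open>D = z\<^sup>2\<close> and \<open>z\<close> about
  \<open>(ln x)\<^sup>1\<^sup>/\<^sup>4\<close>, so that \<open>T \<le> x\<close>. The divisors of \<open>n\<close> that do not divide \<open>T\<close> exceed \<open>D\<close> and contribute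
  at most \<open>1 / D\<close> to \<open>g n\<close> on average, so by Markov's inequality a solution of
  \<open>\<sigma>(n + h) = \<lambda> \<sigma>(n)\<close> satisfies \<open>F n = ln \<lambda> + O(1 / z)\<close> outside a set of size \<open>O(x / z)\<close>, where
  \<open>F r = ln (g (gcd (r + h) T)) - ln (g (gcd r T))\<close> depends on \<open>r\<close> modulo \<open>T\<close> only.

  By multiplicativity \<open>F\<close> is a sum over the primes dividing \<open>T\<close>. For a set \<open>U\<close> of primes \<open>p \<le> z\<close> not
  dividing \<open>h\<close>, the bijection of the residues modulo \<open>T\<close> that acts as \<open>r \<mapsto> - h - r\<close> at the primes in \<open>U\<close>
  and trivially at the others exchanges \<open>r\<close> and \<open>r + h\<close> up to sign at those primes, and so negates exactly
  the terms of \<open>F\<close> indexed by \<open>U\<close>. If \<open>p dvd r\<close> the term at \<open>p\<close> has size at least \<open>1 / (z + 1)\<close>, so by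
  Littlewood--Offord (via Sperner's theorem) at most a proportion \<open>(k + 1)\<^sup>-\<^sup>1\<^sup>/\<^sup>2\<close> of the sign patterns
  lead to a short interval, \<open>k\<close> being the number of such \<open>p\<close>. By Turan's variance bound \<open>k\<close> is
  usually at least half of \<open>\<Sum> 1 / p\<close>, which is of order \<open>ln (ln z)\<close>, hence of order \<open>ln (ln (ln x))\<close>.
\<close>

section \<open>Sperner and Littlewood--Offord\<close>

text \<open>This converts a LYM weight over an \<open>n\<close>-element ground set into weights over
  the ground set with one point removed: a set of size \<open>k\<close> survives the removal of each
  of the \<open>n - k\<close> points outside it.\<close>

lemma binomial_absorb_diff:
  assumes "k < n"
  shows "real (n - k) / real ((n - 1) choose k) = real n / real (n choose k)"
proof -
  have "n * ((n - 1) choose k) = (n - k) * (n choose k)"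
    using binomial_absorb_comp[of n k] by simp
  then have "real n * real ((n - 1) choose k) = real (n - k) * real (n choose k)"
    by (metis of_nat_mult)
  with assms show ?thesis
    by (simp add: field_simps)
qed

lemma LYM_inequality:
  fixes F :: "'a set set"
  assumes "finite A" "F \<subseteq> Pow A" "\<And>X Y. X \<in> F \<Longrightarrow> Y \<in> F \<Longrightarrow> \<not> X \<subset> Y"
  shows "(\<Sum>X\<in>F. 1 / real (card A choose card X)) \<le> 1"
  using assms
proof (induction "card A" arbitrary: A F)
  case 0
  then have "F \<subseteq> {{}}" by auto
  then have "F = {} \<or> F = {{}}" by auto
  with 0 show ?case by auto
next
  case (Suc n)
  show ?case
  proof (cases "A \<in> F")
    case True
    have "F = {A}" using True Suc.prems(2,3) by blast
    then show ?thesis by simp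
  next
    case False
    have finF: "finite F" using Suc.prems by (meson finite_Pow_iff finite_subset)
    have card_less: "card X < card A" and sub: "X \<subseteq> A" and finX: "finite X" if "X \<in> F" for X
    proof -
      show "X \<subseteq> A" using that Suc.prems(2) by auto
      moreover have "X \<noteq> A" using that False by auto
      ultimately show "card X < card A" using Suc.prems(1) by (auto intro!: psubset_card_mono)
      show "finite X" using \<open>X \<subseteq> A\<close> Suc.prems(1) finite_subset by blast
    qed
    \<comment> \<open>Apply the induction hypothesis to \<open>A - {a}\<close> and \<open>{X \<in> F. a \<notin> X}\<close>, and sum over all \<open>a \<in> A\<close>.\<close>
    have "real (card A) * (\<Sum>X\<in>F. 1 / real (card A choose card X))
        = (\<Sum>X\<in>F. real (card (A - X)) / real ((card A - 1) choose card X))"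
      unfolding sum_distrib_left
    proof (rule sum.cong[OF refl])
      fix X assume X: "X \<in> F"
      have "card (A - X) = card A - card X"
        by (rule card_Diff_subset[OF finX[OF X] sub[OF X]])
      with binomial_absorb_diff[OF card_less[OF X]]
      show "real (card A) * (1 / real (card A choose card X))
          = real (card (A - X)) / real ((card A - 1) choose card X)"
        by simp
    qed
    also have "\<dots> = (\<Sum>X\<in>F. \<Sum>a\<in>A. if a \<notin> X then 1 / real ((card A - 1) choose card X) else 0)"
    proof (rule sum.cong[OF refl])
      fix X assume "X \<in> F"
      have "A - X = {a\<in>A. a \<notin> X}" by auto
      then show "real (card (A - X)) / real ((card A - 1) choose card X)
        = (\<Sum>a\<in>A. if a \<notin> X then 1 / real ((card A - 1) choose card X) else 0)"
        using Suc.prems(1) by (simp add: sum.If_cases Int_def)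
    qed
    also have "\<dots> = (\<Sum>a\<in>A. \<Sum>X\<in>F. if a \<notin> X then 1 / real ((card A - 1) choose card X) else 0)"
      by (rule sum.swap)
    also have "\<dots> \<le> (\<Sum>a\<in>A. 1)"
    proof (rule sum_mono)
      fix a assume "a \<in> A"
      have n: "n = card (A - {a})" using \<open>a \<in> A\<close> Suc.hyps(2) by simp
      have "(\<Sum>X\<in>F. if a \<notin> X then 1 / real ((card A - 1) choose card X) else 0)
          = (\<Sum>X\<in>{X\<in>F. a \<notin> X}. 1 / real ((card A - 1) choose card X))"
        by (rule sum.inter_filter[OF finF, symmetric])
      also have "\<dots> = (\<Sum>X\<in>{X\<in>F. a \<notin> X}. 1 / real (card (A - {a}) choose card X))"
        using \<open>a \<in> A\<close> by simp
      also have "\<dots> \<le> 1"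
      proof (rule Suc.hyps(1)[OF n])
        show "finite (A - {a})" using Suc.prems(1) by simp
        show "{X \<in> F. a \<notin> X} \<subseteq> Pow (A - {a})" using Suc.prems(2) by auto
        show "\<not> X \<subset> Y" if "X \<in> {X \<in> F. a \<notin> X}" "Y \<in> {X \<in> F. a \<notin> X}" for X Y
          using that Suc.prems(3) by auto
      qed
      finally show "(\<Sum>X\<in>F. if a \<notin> X then 1 / real ((card A - 1) choose card X) else 0) \<le> 1" .
    qed
    finally have "real (card A) * (\<Sum>X\<in>F. 1 / real (card A choose card X)) \<le> real (card A) * 1"
      by simp
    then show ?thesis
      using Suc.hyps(2) by (subst (asm) mult_le_cancel_left_pos) auto
  qed
qed

corollary Sperner_bound:
  fixes F :: "'a set set"
  assumes "finite A" "F \<subseteq> Pow A" "\<And>X Y. X \<in> F \<Longrightarrow> Y \<in> F \<Longrightarrow> \<not> X \<subset> Y"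
  shows "card F \<le> card A choose (card A div 2)"
proof -
  let ?M = "card A choose (card A div 2)"
  have M: "?M > 0" by (simp add: zero_less_binomial_iff)
  have "real (card F) / real ?M = (\<Sum>X\<in>F. 1 / real ?M)" by simp
  also have "\<dots> \<le> (\<Sum>X\<in>F. 1 / real (card A choose card X))"
  proof (rule sum_mono)
    fix X assume "X \<in> F"
    then have "card X \<le> card A" using assms(1,2) by (auto intro: card_mono)
    then show "1 / real ?M \<le> 1 / real (card A choose card X)"
      using binomial_maximum[of "card A" "card X"]
      by (intro divide_left_mono) (auto simp: M)
  qed
  also have "\<dots> \<le> 1" by (rule LYM_inequality[OF assms])
  finally show ?thesis using M by (simp add: field_simps)
qed

lemma central_binomial_Suc: "(2 * Suc m) choose Suc m = 2 * ((2 * m + 1) choose m)"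
proof -
  have "Suc m * ((2 * Suc m) choose Suc m) = 2 * Suc m * ((2 * Suc m - 1) choose m)"
    by (rule binomial_absorption)
  also have "2 * Suc m - 1 = 2 * m + 1" by simp
  also have "2 * Suc m * ((2 * m + 1) choose m) = Suc m * (2 * ((2 * m + 1) choose m))"
    by (simp only: mult_ac)
  finally show ?thesis by (metis mult_cancel1 nat.distinct(1))
qed

text \<open>Passing from \<open>m\<close> to \<open>Suc m\<close> multiplies the coefficient by
  \<open>2 * (2 * m + 1) / (m + 1)\<close>. Since (2m+1)(2m+3) \<le> (2m+2)^2, the square root
  factor keeps the growth per step at no more than 4.\<close>

lemma central_binomial_even:
  "real ((2 * m) choose m) * sqrt (real (2 * m + 1)) \<le> 4 ^ m"
proof (induction m)
  case 0
  then show ?case by simp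
next
  case (Suc m)
  note central_binomial_Suc[of m]
  moreover have "Suc m * ((2 * m + 1) choose m) = (2 * m + 1) * ((2 * m) choose m)"
    using binomial_absorb_comp[of "2 * m + 1" m] by simp
  ultimately have "Suc m * ((2 * Suc m) choose Suc m) = 2 * (2 * m + 1) * ((2 * m) choose m)"
    by (metis mult.assoc mult.left_commute)
  then have eq: "real (Suc m) * real ((2 * Suc m) choose Suc m)
      = 2 * real (2 * m + 1) * real ((2 * m) choose m)"
    by (metis of_nat_mult of_nat_numeral)
  have "sqrt (real (2 * m + 1)) * sqrt (real (2 * Suc m + 1))
      = sqrt (real (2 * m + 1) * real (2 * Suc m + 1))"
    by (simp add: real_sqrt_mult)
  also have "\<dots> \<le> sqrt ((2 * real (Suc m))\<^sup>2)"
    by (rule real_sqrt_le_mono) (simp add: power2_eq_square algebra_simps)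
  also have "\<dots> = 2 * real (Suc m)" by simp
  finally have s: "sqrt (real (2 * m + 1)) * sqrt (real (2 * Suc m + 1)) \<le> 2 * real (Suc m)" .
  have "real (Suc m) * (real ((2 * Suc m) choose Suc m) * sqrt (real (2 * Suc m + 1)))
      = 2 * (real ((2 * m) choose m) * sqrt (real (2 * m + 1)))
          * (sqrt (real (2 * m + 1)) * sqrt (real (2 * Suc m + 1)))"
    using eq by (simp add: mult_ac)
  also have "\<dots> \<le> 2 * 4 ^ m * (2 * real (Suc m))"
    by (intro mult_mono s mult_left_mono Suc.IH) auto
  also have "\<dots> = real (Suc m) * 4 ^ Suc m" by simp
  finally show ?case by (subst (asm) mult_le_cancel_left_pos) auto
qed

text \<open>For odd \<open>n = 2 * m + 1\<close> the coefficient is half of the central one for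
  \<open>2 * m + 2\<close>, so the even case applies with \<open>Suc m\<close>.\<close>

lemma central_binomial_le:
  "real (n choose (n div 2)) \<le> 2 ^ n / sqrt (real (n + 1))"
proof (cases "even n")
  case True
  then obtain m where m: "n = 2 * m" by blast
  show ?thesis
    using central_binomial_even[of m] unfolding m
    by (simp add: pos_le_divide_eq power_mult)
next
  case False
  then obtain m where m: "n = 2 * m + 1" using oddE by blast
  note e = central_binomial_Suc[of m]
  have "2 * real (n choose m) * sqrt (real (n + 1))
      \<le> 2 * real (n choose m) * sqrt (real (2 * Suc m + 1))"
    by (intro mult_left_mono real_sqrt_le_mono) (auto simp: m)
  also have "\<dots> \<le> 4 ^ Suc m"
    using central_binomial_even[of "Suc m"] unfolding e m by simp
  also have "\<dots> = 2 * 2 ^ n" by (simp add: m power_mult)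
  finally show ?thesis by (simp add: m pos_le_divide_eq)
qed

text \<open>Erdos's argument: enlarging \<open>U\<close> flips some positive terms and lowers the
  signed sum by at least \<open>2 * m\<close>, more than the interval is long. The admissible
  \<open>U\<close> thus form an antichain, and Sperner's bound applies.\<close>

lemma Littlewood_Offord_pos:
  fixes a :: "'a \<Rightarrow> real"
  assumes fin: "finite S" and m: "\<And>i. i \<in> S \<Longrightarrow> m \<le> a i" and "hi - lo < 2 * m" "0 < m"
  shows "card {U\<in>Pow S. (\<Sum>i\<in>S. if i \<in> U then - a i else a i) \<in> {lo..hi}}
      \<le> card S choose (card S div 2)" (is "card ?F \<le> _")
proof (rule Sperner_bound[OF fin])
  show "?F \<subseteq> Pow S" by auto
  fix X Y assume X: "X \<in> ?F" and Y: "Y \<in> ?F"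
  show "\<not> X \<subset> Y"
  proof
    assume "X \<subset> Y"
    then obtain j where j: "j \<in> Y" "j \<notin> X" by blast
    with Y have jS: "j \<in> S" by auto
    let ?f = "\<lambda>U i. if i \<in> U then - a i else a i"
    have "(\<Sum>i\<in>S. ?f X i) - (\<Sum>i\<in>S. ?f Y i) = (\<Sum>i\<in>S. ?f X i - ?f Y i)"
      by (simp add: sum_subtractf)
    also have "\<dots> \<ge> ?f X j - ?f Y j"
    proof (rule member_le_sum[OF jS _ fin])
      fix i assume "i \<in> S - {j}"
      then have "a i > 0" using m[of i] \<open>0 < m\<close> by auto
      then show "0 \<le> ?f X i - ?f Y i" using \<open>X \<subset> Y\<close> by auto
    qed
    finally have "2 * a j \<le> (\<Sum>i\<in>S. ?f X i) - (\<Sum>i\<in>S. ?f Y i)" using j by simp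
    moreover have "(\<Sum>i\<in>S. ?f X i) \<le> hi" "lo \<le> (\<Sum>i\<in>S. ?f Y i)" using X Y by auto
    ultimately show False using m[OF jS] \<open>hi - lo < 2 * m\<close> by linarith
  qed
qed

text \<open>Taking the symmetric difference of \<open>U\<close> with the set of indices of negative
  \<open>a i\<close> is injective and replaces every \<open>a i\<close> by its absolute
  value.\<close>

lemma Littlewood_Offord:
  fixes a :: "'a \<Rightarrow> real"
  assumes fin: "finite S" and m: "\<And>i. i \<in> S \<Longrightarrow> m \<le> \<bar>a i\<bar>" and "hi - lo < 2 * m" "0 < m"
  shows "card {U\<in>Pow S. (\<Sum>i\<in>S. if i \<in> U then - a i else a i) \<in> {lo..hi}}
      \<le> card S choose (card S div 2)" (is "card ?F \<le> _")
proof -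
  define N where "N = {i\<in>S. a i < 0}"
  let ?G = "{U\<in>Pow S. (\<Sum>i\<in>S. if i \<in> U then - \<bar>a i\<bar> else \<bar>a i\<bar>) \<in> {lo..hi}}"
  let ?t = "\<lambda>U. (U - N) \<union> (N - U)"
  have "card ?F \<le> card ?G"
  proof (rule card_inj_on_le)
    show "inj_on ?t ?F" by (rule inj_onI) blast
    show "finite ?G" using fin by simp
    show "?t ` ?F \<subseteq> ?G"
    proof
      fix V assume "V \<in> ?t ` ?F"
      then obtain U where U: "U \<in> ?F" "V = ?t U" by blast
      have "(\<Sum>i\<in>S. if i \<in> V then - \<bar>a i\<bar> else \<bar>a i\<bar>) = (\<Sum>i\<in>S. if i \<in> U then - a i else a i)"
        by (rule sum.cong) (auto simp: U(2) N_def)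
      then show "V \<in> ?G" using U by (auto simp: N_def)
    qed
  qed
  also have "\<dots> \<le> card S choose (card S div 2)"
    by (rule Littlewood_Offord_pos[OF fin m assms(3,4)])
  finally show ?thesis .
qed

text \<open>Once the signs on \<open>J - S\<close> are fixed, their terms only translate the
  interval. Littlewood--Offord on \<open>S\<close> then applies to each of the
  \<open>2 ^ card (J - S)\<close> choices.\<close>

lemma Littlewood_Offord_subset:
  fixes a :: "'a \<Rightarrow> real"
  assumes fin: "finite J" and "S \<subseteq> J" and m: "\<And>i. i \<in> S \<Longrightarrow> m \<le> \<bar>a i\<bar>"
    and "hi - lo < 2 * m" "0 < m"
  shows "real (card {U\<in>Pow J. (\<Sum>i\<in>J. if i \<in> U then - a i else a i) \<in> {lo..hi}})
      \<le> 2 ^ card J / sqrt (real (card S + 1))" (is "real (card ?F) \<le> _")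
proof -
  have finS: "finite S" using fin \<open>S \<subseteq> J\<close> finite_subset by blast
  let ?f = "\<lambda>U i. if i \<in> U then - a i else a i"
  define G where "G W = {V\<in>Pow S. (\<Sum>i\<in>S. ?f V i) \<in> {lo - (\<Sum>i\<in>J - S. ?f W i)..hi - (\<Sum>i\<in>J - S. ?f W i)}}" for W
  have "card ?F \<le> card (Sigma (Pow (J - S)) G)"
  proof (rule card_inj_on_le)
    show "inj_on (\<lambda>U. (U - S, U \<inter> S)) ?F" by (rule inj_onI) blast
    show "finite (Sigma (Pow (J - S)) G)" using fin finS by (auto simp: G_def)
    show "(\<lambda>U. (U - S, U \<inter> S)) ` ?F \<subseteq> Sigma (Pow (J - S)) G"
    proof
      fix z assume "z \<in> (\<lambda>U. (U - S, U \<inter> S)) ` ?F"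
      then obtain U where U: "U \<in> ?F" and z: "z = (U - S, U \<inter> S)" by blast
      have "(\<Sum>i\<in>J. ?f U i) = (\<Sum>i\<in>J - S. ?f U i) + (\<Sum>i\<in>S. ?f U i)"
        by (rule sum.subset_diff[OF \<open>S \<subseteq> J\<close> fin])
      also have "(\<Sum>i\<in>J - S. ?f U i) = (\<Sum>i\<in>J - S. ?f (U - S) i)"
        by (rule sum.cong) auto
      also have "(\<Sum>i\<in>S. ?f U i) = (\<Sum>i\<in>S. ?f (U \<inter> S) i)"
        by (rule sum.cong) auto
      finally have *: "(\<Sum>i\<in>J. ?f U i) = (\<Sum>i\<in>J - S. ?f (U - S) i) + (\<Sum>i\<in>S. ?f (U \<inter> S) i)" .
      have "lo \<le> (\<Sum>i\<in>J. ?f U i)" "(\<Sum>i\<in>J. ?f U i) \<le> hi" "U \<subseteq> J" using U by auto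
      then show "z \<in> Sigma (Pow (J - S)) G"
        unfolding z G_def * by auto
    qed
  qed
  also have "\<dots> = (\<Sum>W\<in>Pow (J - S). card (G W))"
    using fin finS by (subst card_SigmaI) (auto simp: G_def)
  also have "\<dots> \<le> (\<Sum>W\<in>Pow (J - S). card S choose (card S div 2))"
  proof (rule sum_mono)
    fix W
    show "card (G W) \<le> card S choose (card S div 2)"
      unfolding G_def by (rule Littlewood_Offord[OF finS m]) (use assms in auto)
  qed
  also have "\<dots> = 2 ^ card (J - S) * (card S choose (card S div 2))"
    using fin by (simp add: card_Pow)
  finally have "real (card ?F) \<le> real (2 ^ card (J - S) * (card S choose (card S div 2)))"
    by (rule of_nat_mono)
  also have "\<dots> = 2 ^ card (J - S) * real (card S choose (card S div 2))"
    by simp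
  also have "\<dots> \<le> 2 ^ card (J - S) * (2 ^ card S / sqrt (real (card S + 1)))"
    by (intro mult_left_mono central_binomial_le) auto
  also have "\<dots> = 2 ^ card J / sqrt (real (card S + 1))"
  proof -
    have "card J = card (J - S) + card S"
      using card_Diff_subset[OF finS \<open>S \<subseteq> J\<close>] card_mono[OF fin \<open>S \<subseteq> J\<close>] by simp
    then show ?thesis by (simp add: power_add)
  qed
  finally show ?thesis .
qed

section \<open>Local factors of the abundancy index\<close>

lemma gcd_mult_distrib_coprime:
  fixes a b d :: "'a :: {semiring_gcd, semiring_gcd_mult_normalize}"
  assumes "coprime a b"
  shows "gcd d (a * b) = gcd d a * gcd d b"
proof (rule associated_eqI)
  show "gcd d a * gcd d b dvd gcd d (a * b)"
    using assms by (intro gcd_greatest mult_dvd_mono divides_mult coprime_divisors[OF _ _ assms]) auto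
  obtain x y where "gcd d (a * b) = x * y" "x dvd a" "y dvd b"
    using division_decomp[of "gcd d (a * b)" a b] by auto
  then show "gcd d (a * b) dvd gcd d a * gcd d b"
    by (metis dvd_mult_left dvd_mult_right gcd_dvd1 gcd_greatest mult_dvd_mono)
qed (simp_all add: normalize_mult)

text \<open>Reciprocals of divisors, rather than a quotient, make it possible to cut off the large
  divisors. At 0 the index set is infinite and the sum takes the default value 0, hence the
  positivity hypotheses below.\<close>

definition abundancy :: "nat \<Rightarrow> real" where
  "abundancy n = (\<Sum>d | d dvd n. 1 / real d)"

lemma abundancy_1: "abundancy 1 = 1"
  by (simp add: abundancy_def)

lemma abundancy_ge_1: "n > 0 \<Longrightarrow> abundancy n \<ge> 1"
proof -
  assume "n > 0"
  then have "(\<Sum>d\<in>{1}. 1 / real d) \<le> abundancy n"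
    unfolding abundancy_def by (intro sum_mono2) auto
  then show ?thesis by simp
qed

lemma abundancy_ge_of_prime_dvd:
  assumes "n > 0" "prime p" "p dvd n"
  shows "abundancy n \<ge> 1 + 1 / real p"
proof -
  have "(\<Sum>d\<in>{1, p}. 1 / real d) \<le> abundancy n"
    unfolding abundancy_def using assms by (intro sum_mono2) auto
  moreover have "p \<noteq> 1" using assms by auto
  ultimately show ?thesis by simp
qed

lemma abundancy_mult_coprime:
  assumes "coprime a b" "a > 0" "b > 0"
  shows "abundancy (a * b) = abundancy a * abundancy b"
proof -
  have "abundancy a * abundancy b
      = (\<Sum>(d, e)\<in>{d. d dvd a} \<times> {e. e dvd b}. 1 / real (d * e))"
    by (simp add: abundancy_def sum_product sum.cartesian_product)
  also have "\<dots> = abundancy (a * b)"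
    unfolding abundancy_def
  proof (rule sum.reindex_bij_witness[of _ "\<lambda>d. (gcd d a, gcd d b)" "\<lambda>(d, e). d * e"])
    fix x assume x: "x \<in> {d. d dvd a} \<times> {e. e dvd b}"
    then obtain d e where de: "x = (d, e)" "d dvd a" "e dvd b" by auto
    have "coprime e a" "coprime d b"
      using assms(1) de coprime_divisors coprime_commute by (metis dvd_refl)+
    then have "gcd (d * e) a = gcd d a" "gcd (d * e) b = gcd e b"
      by (simp_all add: gcd_mult_left_right_cancel gcd_mult_left_left_cancel coprime_commute)
    then show "(gcd (case x of (d, e) \<Rightarrow> d * e) a, gcd (case x of (d, e) \<Rightarrow> d * e) b) = x"
      using de by (simp add: gcd_nat.absorb1)
    show "(case x of (d, e) \<Rightarrow> d * e) \<in> {d. d dvd a * b}" using de by (simp add: mult_dvd_mono)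
    show "1 / real (case x of (d, e) \<Rightarrow> d * e) = (case x of (d, e) \<Rightarrow> 1 / real (d * e))"
      using de by simp
  next
    fix d assume d: "d \<in> {d. d dvd a * b}"
    then have "gcd d a * gcd d b = gcd d (a * b)"
      using assms(1) by (metis gcd_mult_distrib_coprime)
    then show "(case (gcd d a, gcd d b) of (d, e) \<Rightarrow> d * e) = d"
      using d by (simp add: gcd_nat.absorb1)
    show "(gcd d a, gcd d b) \<in> {d. d dvd a} \<times> {e. e dvd b}" by simp
  qed
  finally show ?thesis ..
qed

text \<open>The argument is an integer because reflections lead to negative residues. Through the
  gcd the function is even and periodic modulo \<open>q\<close>; for a prime power \<open>q\<close>
  exactly dividing \<open>T\<close> it is the contribution of one prime.\<close>

definition local_log :: "nat \<Rightarrow> int \<Rightarrow> real" where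
  "local_log q r = ln (abundancy (nat (gcd r (int q))))"

lemma local_log_cong: "[r = s] (mod int q) \<Longrightarrow> local_log q r = local_log q s"
  by (simp add: local_log_def cong_gcd_eq)

lemma local_log_uminus [simp]: "local_log q (- r) = local_log q r"
  by (simp add: local_log_def)

lemma local_log_mult_coprime:
  assumes "coprime a b" "a > 0" "b > 0"
  shows "local_log (a * b) r = local_log a r + local_log b r"
proof -
  have *: "gcd r (int (a * b)) = gcd r (int a) * gcd r (int b)"
    using assms(1) by (metis coprime_int_iff gcd_mult_distrib_coprime of_nat_mult)
  have pos: "nat (gcd r (int a)) > 0" "nat (gcd r (int b)) > 0" using assms by auto
  have "coprime (nat (gcd r (int a))) (nat (gcd r (int b)))"
  proof (rule coprime_divisors[OF _ _ assms(1)])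
    show "nat (gcd r (int a)) dvd a" "nat (gcd r (int b)) dvd b"
      using gcd_dvd2 by (simp_all add: nat_dvd_iff)
  qed
  then have "abundancy (nat (gcd r (int (a * b))))
      = abundancy (nat (gcd r (int a))) * abundancy (nat (gcd r (int b)))"
    unfolding * using abundancy_mult_coprime pos by (simp add: nat_mult_distrib)
  then show ?thesis
    unfolding local_log_def using abundancy_ge_1[OF pos(1)] abundancy_ge_1[OF pos(2)]
    by (simp add: ln_mult)
qed

lemma local_log_prod:
  assumes "finite I" "\<And>i j. i \<in> I \<Longrightarrow> j \<in> I \<Longrightarrow> i \<noteq> j \<Longrightarrow> coprime (q i) (q j)"
    "\<And>i. i \<in> I \<Longrightarrow> q i > 0"
  shows "local_log (\<Prod>i\<in>I. q i) r = (\<Sum>i\<in>I. local_log (q i) r)"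
  using assms
proof (induction I rule: finite_induct)
  case empty
  then show ?case by (simp add: local_log_def abundancy_1[simplified])
next
  case (insert i I)
  have "coprime (q i) (\<Prod>j\<in>I. q j)"
    using insert by (intro prod_coprime_right) auto
  moreover have "(\<Prod>j\<in>I. q j) > 0" using insert by (intro prod_pos) auto
  ultimately show ?case using insert by (simp add: local_log_mult_coprime)
qed

lemma local_log_coprime: "coprime r (int q) \<Longrightarrow> local_log q r = 0"
  by (simp add: local_log_def abundancy_1[simplified])

lemma local_log_ge:
  assumes "q > 0" "prime p" "p dvd q" "int p dvd r"
  shows "local_log q r \<ge> ln (1 + 1 / real p)"
proof -
  have "int p dvd gcd r (int q)" using assms by auto
  then have "p dvd nat (gcd r (int q))" by (simp flip: int_dvd_int_iff)
  moreover have "nat (gcd r (int q)) > 0" using assms by auto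
  ultimately have "abundancy (nat (gcd r (int q))) \<ge> 1 + 1 / real p"
    using abundancy_ge_of_prime_dvd assms(2) by blast
  moreover have "1 + 1 / real p > 0" by (simp add: add_pos_nonneg)
  ultimately show ?thesis unfolding local_log_def by (subst ln_le_cancel_iff) auto
qed

definition shift_log :: "int \<Rightarrow> nat \<Rightarrow> int \<Rightarrow> real" where
  "shift_log h q r = local_log q (r + h) - local_log q r"

lemma shift_log_cong: "[r = s] (mod int q) \<Longrightarrow> shift_log h q r = shift_log h q s"
  unfolding shift_log_def by (metis local_log_cong cong_add_rcancel)

text \<open>The reflection sends \<open>r\<close> to \<open>- (r + h)\<close> and
  \<open>r + h\<close> to \<open>- r\<close>. As \<open>local_log\<close> is even, the two terms of
  the difference change places.\<close>

lemma shift_log_reflect: "shift_log h q (- h - r) = - shift_log h q r"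
proof -
  have "- h - r = - (r + h)" "- h - r + h = - r" by simp_all
  then show ?thesis unfolding shift_log_def by (metis local_log_uminus minus_diff_eq)
qed

lemma shift_log_prod:
  assumes "finite I" "\<And>i j. i \<in> I \<Longrightarrow> j \<in> I \<Longrightarrow> i \<noteq> j \<Longrightarrow> coprime (q i) (q j)"
    "\<And>i. i \<in> I \<Longrightarrow> q i > 0"
  shows "shift_log h (\<Prod>i\<in>I. q i) r = (\<Sum>i\<in>I. shift_log h (q i) r)"
  unfolding shift_log_def by (simp add: local_log_prod[OF assms] sum_subtractf)

text \<open>From \<open>p\<close> dividing \<open>r\<close> but not \<open>h\<close> it follows that
  \<open>p\<close> does not divide \<open>r + h\<close>. The term at \<open>r + h\<close> therefore
  vanishes, while the divisor \<open>p\<close> contributes to the term at \<open>r\<close>.\<close>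

lemma abs_shift_log_ge:
  assumes "q = p ^ k" "k > 0" "prime p" "int p dvd r" "\<not> int p dvd h"
  shows "\<bar>shift_log h q r\<bar> \<ge> ln (1 + 1 / real p)"
proof -
  have "\<not> int p dvd r + h" using assms(4,5) by (simp add: dvd_add_right_iff)
  moreover have "prime (int p)" using assms(3) by simp
  ultimately have "coprime (r + h) (int q)"
    using prime_imp_coprime[of "int p" "r + h"] unfolding assms(1)
    by (simp add: coprime_commute)
  then have "local_log q (r + h) = 0" by (rule local_log_coprime)
  moreover have "local_log q r \<ge> ln (1 + 1 / real p)"
    using assms by (intro local_log_ge) (auto simp: prime_gt_0_nat)
  moreover have "ln (1 + 1 / real p) \<ge> 0" by simp
  ultimately show ?thesis unfolding shift_log_def by linarith
qed

text \<open>Identity and reflection are injective modulo each \<open>q i\<close>. The Chinese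
  remainder theorem glues them to an injective map modulo \<open>T\<close>, which is surjective by
  finiteness.\<close>

lemma swap_residues:
  fixes q :: "'i \<Rightarrow> nat" and h :: int
  assumes fin: "finite I" and cop: "\<And>i j. i \<in> I \<Longrightarrow> j \<in> I \<Longrightarrow> i \<noteq> j \<Longrightarrow> coprime (q i) (q j)"
    and pos: "\<And>i. i \<in> I \<Longrightarrow> q i > 0" and T: "T = (\<Prod>i\<in>I. q i)"
  shows "\<exists>\<tau>. bij_betw \<tau> {0..<int T} {0..<int T} \<and>
    (\<forall>r. \<forall>i\<in>I. [\<tau> r = (if i \<in> U then - h - r else r)] (mod int (q i)))"
proof -
  obtain c where c: "\<forall>i\<in>I. [c = (if i \<in> U then 1 else 0)] (mod q i)"
    using chinese_remainder_nat[OF fin, of q "\<lambda>i. if i \<in> U then 1 else 0"] cop by auto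
  have c': "[int c = (if i \<in> U then 1 else 0)] (mod int (q i))" if "i \<in> I" for i
    using c that by (metis (full_types) cong_int_iff of_nat_0 of_nat_1)
  have Tpos: "T > 0" unfolding T using pos by (intro prod_pos) auto
  \<comment> \<open>The expression is \<open>r\<close> where \<open>c\<close> is congruent to 0 and
    \<open>- h - r\<close> where \<open>c\<close> is congruent to 1, so one \<open>c\<close> serves
    all \<open>r\<close>.\<close>
  define \<tau> where "\<tau> r = (r - int c * (2 * r + h)) mod int T" for r
  have dv: "int (q i) dvd int T" if "i \<in> I" for i
    using fin that unfolding T by (metis dvd_prodI int_dvd_int_iff)
  have \<tau>: "[\<tau> r = r - (if i \<in> U then 1 else 0) * (2 * r + h)] (mod int (q i))" if "i \<in> I" for i r
  proof -
    have "[\<tau> r = r - int c * (2 * r + h)] (mod int T)"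
      by (simp add: \<tau>_def cong_def)
    then have "[\<tau> r = r - int c * (2 * r + h)] (mod int (q i))"
      using dv[OF that] by (rule cong_dvd_modulus)
    also have "[r - int c * (2 * r + h) = r - (if i \<in> U then 1 else 0) * (2 * r + h)] (mod int (q i))"
      by (intro cong_diff cong_mult c' that cong_refl)
    finally show ?thesis .
  qed
  show ?thesis
  proof (intro exI[of _ \<tau>] conjI allI ballI)
    show \<tau>': "[\<tau> r = (if i \<in> U then - h - r else r)] (mod int (q i))" if "i \<in> I" for r i
      using \<tau>[OF that, of r] by (cases "i \<in> U") (simp_all add: algebra_simps)
    have "inj_on \<tau> {0..<int T}"
    proof (rule inj_onI)
      fix r s assume rs: "r \<in> {0..<int T}" "s \<in> {0..<int T}" "\<tau> r = \<tau> s"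
      have "[r = s] (mod int (q i))" if "i \<in> I" for i
      proof -
        have *: "[(if i \<in> U then - h - r else r) = \<tau> s] (mod int (q i))"
          using cong_sym[OF \<tau>'[OF that, of r]] unfolding rs(3) .
        have "[(if i \<in> U then - h - r else r) = (if i \<in> U then - h - s else s)] (mod int (q i))"
          by (rule cong_trans[OF * \<tau>'[OF that]])
        then show ?thesis
          by (cases "i \<in> U") (simp_all add: cong_iff_dvd_diff dvd_diff_commute)
      qed
      then have "[r = s] (mod (\<Prod>i\<in>I. int (q i)))"
        using cop by (intro cong_cong_prod_coprime) auto
      then have "[r = s] (mod int T)" by (simp add: T)
      then show "r = s" using rs(1,2) cong_less_imp_eq_int by auto
    qed
    moreover have "\<tau> ` {0..<int T} \<subseteq> {0..<int T}" using Tpos by (auto simp: \<tau>_def)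
    ultimately show "bij_betw \<tau> {0..<int T} {0..<int T}"
      by (simp add: bij_betw_def endo_inj_surj)
  qed
qed

section \<open>Concentration over residue classes\<close>

lemma ln_one_plus_inverse_ge:
  assumes "(p::nat) > 0" shows "ln (1 + 1 / real p) \<ge> 1 / (real p + 1)"
proof -
  have "ln (real p / (real p + 1)) \<le> real p / (real p + 1) - 1"
    using assms by (intro ln_le_minus_one) simp
  also have "\<dots> = - (1 / (real p + 1))" by (simp add: field_simps)
  also have "ln (real p / (real p + 1)) = - ln ((real p + 1) / real p)"
    using assms by (subst (1 2) ln_div) auto
  also have "(real p + 1) / real p = 1 + 1 / real p" using assms by (simp add: field_simps)
  finally show ?thesis by simp
qed

lemma concentration_bound:
  fixes T z :: nat and h :: int and J :: "nat set"
  assumes T: "T > 0" and J: "\<And>p. p \<in> J \<Longrightarrow> prime p \<and> p dvd T \<and> p \<le> z \<and> \<not> int p dvd h"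
    and w: "hi - lo < 2 / (real z + 1)"
  shows "real (card {r\<in>{0..<int T}. shift_log h T r \<in> {lo..hi}})
    \<le> (\<Sum>r\<in>{0..<int T}. 1 / sqrt (real (card {p\<in>J. int p dvd r} + 1)))"
proof -
  \<comment> \<open>\<open>I\<close> indexes the full prime power factors \<open>q p\<close> of
    \<open>T\<close>; signs are flipped only at the primes in \<open>J\<close>.\<close>
  define I where "I = prime_factors T"
  define q where "q p = p ^ multiplicity p T" for p :: nat
  let ?R = "{0..<int T}"
  define B where "B = {r\<in>?R. shift_log h T r \<in> {lo..hi}}"
  have finI: "finite I" by (simp add: I_def)
  have JI: "J \<subseteq> I" using J T by (auto simp: I_def prime_factors_dvd)
  have finJ: "finite J" using finI JI finite_subset by blast
  have cop: "coprime (q i) (q j)" if "i \<in> I" "j \<in> I" "i \<noteq> j" for i j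
    using that unfolding q_def I_def by (auto intro!: primes_coprime)
  have qpos: "q i > 0" if "i \<in> I" for i
    using that prime_gt_0_nat unfolding q_def I_def by (simp add: in_prime_factors_imp_prime)
  have Tprod: "T = (\<Prod>i\<in>I. q i)"
    using prod_prime_factors[of T] T by (simp add: I_def q_def)
  have "\<exists>\<tau>. bij_betw \<tau> ?R ?R \<and>
      (\<forall>r. \<forall>i\<in>I. [\<tau> r = (if i \<in> U then - h - r else r)] (mod int (q i)))" for U
    using finI cop qpos Tprod by (rule swap_residues)
  then obtain \<tau> where bij: "\<And>U. bij_betw (\<tau> U) ?R ?R"
    and \<tau>: "\<And>U r i. i \<in> I \<Longrightarrow> [\<tau> U r = (if i \<in> U then - h - r else r)] (mod int (q i))"
    by metis
  have shift: "shift_log h T (\<tau> U r) = (\<Sum>i\<in>I - J. shift_log h (q i) r)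
      + (\<Sum>i\<in>J. if i \<in> U then - shift_log h (q i) r else shift_log h (q i) r)"
    if "U \<subseteq> J" for U r
  proof -
    have "shift_log h T (\<tau> U r) = (\<Sum>i\<in>I. shift_log h (q i) (\<tau> U r))"
      unfolding Tprod by (rule shift_log_prod[OF finI cop qpos])
    also have "\<dots> = (\<Sum>i\<in>I. if i \<in> U then - shift_log h (q i) r else shift_log h (q i) r)"
      by (intro sum.cong refl)
         (auto simp: shift_log_cong[OF \<tau>] shift_log_reflect)
    also have "\<dots> = (\<Sum>i\<in>I - J. if i \<in> U then - shift_log h (q i) r else shift_log h (q i) r)
        + (\<Sum>i\<in>J. if i \<in> U then - shift_log h (q i) r else shift_log h (q i) r)"
      by (rule sum.subset_diff[OF JI finI])
    also have "(\<Sum>i\<in>I - J. if i \<in> U then - shift_log h (q i) r else shift_log h (q i) r)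
        = (\<Sum>i\<in>I - J. shift_log h (q i) r)"
      using that by (intro sum.cong) auto
    finally show ?thesis .
  qed
  have count: "real (card {U\<in>Pow J. \<tau> U r \<in> B}) \<le> 2 ^ card J / sqrt (real (card {p\<in>J. int p dvd r} + 1))"
    (is "_ \<le> ?rhs") if r: "r \<in> ?R" for r
  proof -
    let ?c = "\<Sum>i\<in>I - J. shift_log h (q i) r"
    \<comment> \<open>For fixed \<open>r\<close> the primes outside \<open>J\<close> contribute the
      constant \<open>?c\<close>. Among those in \<open>J\<close>, only the divisors of
      \<open>r\<close> are known to have large terms, and they form the set \<open>S\<close> of
      \<open>Littlewood_Offord_subset\<close>.\<close>
    have "{U\<in>Pow J. \<tau> U r \<in> B} = {U\<in>Pow J.
        (\<Sum>i\<in>J. if i \<in> U then - shift_log h (q i) r else shift_log h (q i) r) \<in> {lo - ?c..hi - ?c}}"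
      using bij_betwE[OF bij] r by (auto simp: B_def shift)
    moreover have "real (card {U\<in>Pow J.
        (\<Sum>i\<in>J. if i \<in> U then - shift_log h (q i) r else shift_log h (q i) r) \<in> {lo - ?c..hi - ?c}}) \<le> ?rhs"
    proof (rule Littlewood_Offord_subset[OF finJ])
      fix p assume p: "p \<in> {p\<in>J. int p dvd r}"
      then have pp: "prime p" "p dvd T" "p \<le> z" "\<not> int p dvd h" "int p dvd r" using J by auto
      have "1 / (real z + 1) \<le> 1 / (real p + 1)" using pp by (simp add: frac_le)
      also have "\<dots> \<le> ln (1 + 1 / real p)"
        using pp by (intro ln_one_plus_inverse_ge) (simp add: prime_gt_0_nat)
      also have "\<dots> \<le> \<bar>shift_log h (q p) r\<bar>"
        using pp T by (intro abs_shift_log_ge[OF q_def]) (auto simp: prime_multiplicity_gt_zero_iff)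
      finally show "1 / (real z + 1) \<le> \<bar>shift_log h (q p) r\<bar>" .
    qed (use w in auto)
    ultimately show ?thesis by simp
  qed
  \<comment> \<open>Each \<open>\<tau> U\<close> permutes the residues, so \<open>card B\<close> may be averaged over all sign patterns \<open>U\<close>.\<close>
  have "2 ^ card J * real (card B) = (\<Sum>U\<in>Pow J. real (card B))"
    using finJ by (simp add: card_Pow)
  also have "\<dots> = (\<Sum>U\<in>Pow J. \<Sum>r\<in>?R. if \<tau> U r \<in> B then 1 else 0)"
  proof (rule sum.cong[OF refl])
    fix U
    have "(\<Sum>r\<in>?R. if \<tau> U r \<in> B then 1 else 0 :: real) = (\<Sum>r\<in>?R. if r \<in> B then 1 else 0)"
      by (rule sum.reindex_bij_betw[OF bij])
    also have "\<dots> = real (card {r\<in>?R. r \<in> B})" by (simp add: sum.If_cases Int_def)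
    also have "{r\<in>?R. r \<in> B} = B" by (auto simp: B_def)
    finally show "real (card B) = (\<Sum>r\<in>?R. if \<tau> U r \<in> B then 1 else 0)" ..
  qed
  also have "\<dots> = (\<Sum>r\<in>?R. \<Sum>U\<in>Pow J. if \<tau> U r \<in> B then 1 else 0)"
    by (rule sum.swap)
  also have "\<dots> = (\<Sum>r\<in>?R. real (card {U\<in>Pow J. \<tau> U r \<in> B}))"
    using finJ by (simp add: sum.If_cases Int_def)
  also have "\<dots> \<le> (\<Sum>r\<in>?R. 2 ^ card J / sqrt (real (card {p\<in>J. int p dvd r} + 1)))"
    by (rule sum_mono) (rule count)
  also have "\<dots> = 2 ^ card J * (\<Sum>r\<in>?R. 1 / sqrt (real (card {p\<in>J. int p dvd r} + 1)))"
    by (simp add: sum_distrib_left)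
  finally show ?thesis
    unfolding B_def by (subst (asm) mult_le_cancel_left_pos) auto
qed

section \<open>Mean and variance of the number of prime divisors\<close>

lemma card_multiples:
  assumes "d dvd T" "(d::nat) > 0"
  shows "card {r\<in>{0..<int T}. int d dvd r} = T div d"
proof -
  obtain k where k: "T = d * k" using assms by blast
  have "{r\<in>{0..<int T}. int d dvd r} = (\<lambda>j. int d * int j) ` {0..<k}"
  proof safe
    fix r assume r: "r \<in> {0..<int T}" "int d dvd r"
    then obtain j where j: "r = int d * j" by blast
    have "0 \<le> j" "j < int k" using r assms(2) unfolding j k by (auto simp: zero_le_mult_iff)
    then show "r \<in> (\<lambda>j. int d * int j) ` {0..<k}" unfolding j
      by (intro image_eqI[of _ _ "nat j"]) auto
  next
    fix j assume "j \<in> {0..<k}"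
    then show "int d * int j \<in> {0..<int T}" using assms(2) by (auto simp: k)
  qed auto
  moreover have "card ((\<lambda>j. int d * int j) ` {0..<k}) = k"
    using assms(2) by (subst card_image) (auto simp: inj_on_def)
  ultimately show ?thesis using assms(2) k by simp
qed

lemma sum_indicator_multiples:
  assumes "d dvd T" "(d::nat) > 0"
  shows "(\<Sum>r\<in>{0..<int T}. of_bool (int d dvd r)) = real T / real d"
proof -
  have "(\<Sum>r\<in>{0..<int T}. of_bool (int d dvd r) :: real) = real (card {r\<in>{0..<int T}. int d dvd r})"
    by (simp add: of_bool_def sum.If_cases Int_def)
  then show ?thesis using card_multiples[OF assms] assms by (simp add: real_of_nat_div)
qed

text \<open>For distinct primes of \<open>J\<close> the product also divides \<open>T\<close>, so
  their divisibility events are exactly independent over a complete residue system. Only the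
  diagonal enters the variance, and it contributes at most \<open>\<mu>\<close> on average.\<close>

lemma Turan_Kubilius:
  fixes J :: "nat set" and T :: nat
  assumes finJ: "finite J" and J: "\<And>p. p \<in> J \<Longrightarrow> prime p \<and> p dvd T"
    and \<mu>: "\<mu> = (\<Sum>p\<in>J. 1 / real p)"
  shows "(\<Sum>r\<in>{0..<int T}. (real (card {p\<in>J. int p dvd r}) - \<mu>)\<^sup>2) \<le> real T * \<mu>"
proof -
  let ?R = "{0..<int T}"
  let ?e = "\<lambda>p r. of_bool (int p dvd r) :: real"
  have W: "real (card {p\<in>J. int p dvd r}) = (\<Sum>p\<in>J. ?e p r)" for r
    using finJ by (simp add: of_bool_def sum.If_cases Int_def)
  have pos: "p > 0" if "p \<in> J" for p using J[OF that] prime_gt_0_nat by blast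
  have m1: "(\<Sum>r\<in>?R. ?e p r) = real T / real p" if "p \<in> J" for p
    using J[OF that] pos[OF that] by (intro sum_indicator_multiples) auto
  \<comment> \<open>The product term is kept on the diagonal as well, at the price of an inequality,
    so that the double sum factors into \<open>\<mu> * \<mu>\<close>.\<close>
  have m2: "(\<Sum>r\<in>?R. ?e p r * ?e p' r) \<le> real T / (real p * real p') + (if p = p' then real T / real p else 0)"
    if "p \<in> J" "p' \<in> J" for p p'
  proof (cases "p = p'")
    case True
    have "(\<Sum>r\<in>?R. ?e p r * ?e p' r) = (\<Sum>r\<in>?R. ?e p r)" using True by (intro sum.cong) auto
    then show ?thesis using True m1[OF that(1)] by simp
  next
    case False
    then have cop: "coprime p p'" using J that primes_coprime by blast
    have "(\<Sum>r\<in>?R. ?e p r * ?e p' r) = (\<Sum>r\<in>?R. ?e (p * p') r)"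
    proof (rule sum.cong[OF refl])
      fix r
      have "int (p * p') dvd r \<longleftrightarrow> int p dvd r \<and> int p' dvd r"
        using cop by (metis coprime_int_iff divides_mult dvd_mult_left dvd_mult_right of_nat_mult)
      then show "?e p r * ?e p' r = ?e (p * p') r" by auto
    qed
    also have "\<dots> = real T / real (p * p')"
      using cop J that pos by (intro sum_indicator_multiples) (auto intro: divides_mult)
    finally show ?thesis using False by simp
  qed
  have "(\<Sum>r\<in>?R. (\<Sum>p\<in>J. ?e p r)\<^sup>2) = (\<Sum>p\<in>J. \<Sum>p'\<in>J. \<Sum>r\<in>?R. ?e p r * ?e p' r)"
    unfolding power2_eq_square sum_product
    by (subst sum.swap, rule sum.cong[OF refl], subst sum.swap, rule refl)
  also have "\<dots> \<le> (\<Sum>p\<in>J. \<Sum>p'\<in>J. real T / (real p * real p') + (if p = p' then real T / real p else 0))"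
    by (intro sum_mono m2)
  also have "\<dots> = (\<Sum>p\<in>J. \<Sum>p'\<in>J. real T / (real p * real p')) + (\<Sum>p\<in>J. real T / real p)"
    using finJ by (simp add: sum.distrib)
  also have "(\<Sum>p\<in>J. \<Sum>p'\<in>J. real T / (real p * real p')) = real T * (\<mu> * \<mu>)"
    unfolding \<mu> sum_product by (simp only: sum_distrib_left) simp
  also have "(\<Sum>p\<in>J. real T / real p) = real T * \<mu>"
    unfolding \<mu> sum_distrib_left by simp
  finally have sq: "(\<Sum>r\<in>?R. (\<Sum>p\<in>J. ?e p r)\<^sup>2) \<le> real T * (\<mu> * \<mu>) + real T * \<mu>" .
  have lin: "(\<Sum>r\<in>?R. \<Sum>p\<in>J. ?e p r) = real T * \<mu>"
  proof -
    have "(\<Sum>r\<in>?R. \<Sum>p\<in>J. ?e p r) = (\<Sum>p\<in>J. \<Sum>r\<in>?R. ?e p r)" by (rule sum.swap)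
    also have "\<dots> = (\<Sum>p\<in>J. real T / real p)" by (rule sum.cong[OF refl m1])
    finally show ?thesis unfolding \<mu> sum_distrib_left by simp
  qed
  have "(\<Sum>r\<in>?R. ((\<Sum>p\<in>J. ?e p r) - \<mu>)\<^sup>2)
      = (\<Sum>r\<in>?R. (\<Sum>p\<in>J. ?e p r)\<^sup>2) - 2 * \<mu> * (\<Sum>r\<in>?R. \<Sum>p\<in>J. ?e p r) + real T * \<mu>\<^sup>2"
    by (simp add: power2_diff sum.distrib sum_subtractf sum_distrib_left mult_ac)
  also have "\<dots> \<le> real T * \<mu>"
    using sq unfolding lin by (simp add: power2_eq_square algebra_simps)
  finally show ?thesis unfolding W .
qed

text \<open>Pointwise, a count of at least \<open>\<mu> / 2\<close> gives
  \<open>sqrt (2 / \<mu>)\<close>. Otherwise the trivial bound 1 is dominated by four times the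
  squared deviation over \<open>\<mu>\<^sup>2\<close>, whose average is at most
  \<open>4 / \<mu>\<close> by the variance bound.\<close>

lemma average_inverse_sqrt_bound:
  fixes J :: "nat set" and T :: nat
  assumes finJ: "finite J" and J: "\<And>p. p \<in> J \<Longrightarrow> prime p \<and> p dvd T"
    and \<mu>: "\<mu> = (\<Sum>p\<in>J. 1 / real p)" "\<mu> > 0"
  shows "(\<Sum>r\<in>{0..<int T}. 1 / sqrt (real (card {p\<in>J. int p dvd r} + 1)))
    \<le> real T * (sqrt (2 / \<mu>) + 4 / \<mu>)"
proof -
  let ?W = "\<lambda>r. real (card {p\<in>J. int p dvd r})"
  have "(\<Sum>r\<in>{0..<int T}. 1 / sqrt (real (card {p\<in>J. int p dvd r} + 1)))
    \<le> (\<Sum>r\<in>{0..<int T}. sqrt (2 / \<mu>) + 4 / \<mu>\<^sup>2 * (?W r - \<mu>)\<^sup>2)"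
  proof (rule sum_mono)
    fix r :: int
    show "1 / sqrt (real (card {p\<in>J. int p dvd r} + 1)) \<le> sqrt (2 / \<mu>) + 4 / \<mu>\<^sup>2 * (?W r - \<mu>)\<^sup>2"
    proof (cases "?W r \<ge> \<mu> / 2")
      case True
      have "1 / sqrt (?W r + 1) = sqrt (1 / (?W r + 1))" by (simp add: real_sqrt_divide)
      also have "\<dots> \<le> sqrt (2 / \<mu>)"
        using True \<mu>(2) by (intro real_sqrt_le_mono) (simp add: field_simps)
      finally show ?thesis using \<mu>(2) by (simp add: add.commute add_increasing2)
    next
      case False
      have "(\<mu> / 2)\<^sup>2 \<le> (\<mu> - ?W r)\<^sup>2" using False \<mu>(2) by (intro power_mono) auto
      then have "1 \<le> 4 / \<mu>\<^sup>2 * (?W r - \<mu>)\<^sup>2"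
        using \<mu>(2) by (simp add: field_simps power2_commute)
      moreover have "1 / sqrt (real (card {p\<in>J. int p dvd r} + 1)) \<le> 1" by simp
      moreover have "sqrt (2 / \<mu>) \<ge> 0" using \<mu>(2) by simp
      ultimately show ?thesis by linarith
    qed
  qed
  also have "\<dots> = real T * sqrt (2 / \<mu>) + 4 / \<mu>\<^sup>2 * (\<Sum>r\<in>{0..<int T}. (?W r - \<mu>)\<^sup>2)"
    by (simp add: sum.distrib sum_distrib_left)
  also have "\<dots> \<le> real T * sqrt (2 / \<mu>) + 4 / \<mu>\<^sup>2 * (real T * \<mu>)"
    using Turan_Kubilius[OF finJ J \<mu>(1)] by (intro add_left_mono mult_left_mono) auto
  also have "\<dots> = real T * (sqrt (2 / \<mu>) + 4 / \<mu>)"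
    using \<mu>(2) by (simp add: field_simps power2_eq_square)
  finally show ?thesis .
qed

section \<open>Reciprocals of primes\<close>

text \<open>A finite Euler product by induction on the set of primes: a number composed of primes
  from \<open>insert p P\<close> either avoids \<open>p\<close> or is \<open>p\<close> times another
  such number. The sum therefore grows by a factor of at most 1 / (1 - 1/p).\<close>

lemma smooth_harmonic_sum_le:
  assumes "finite P" "\<And>p. p \<in> P \<Longrightarrow> prime p"
  shows "(\<Sum>n | n \<in> {1..z} \<and> prime_factors n \<subseteq> P. 1 / real n) \<le> exp (2 * (\<Sum>p\<in>P. 1 / real p))"
  using assms
proof (induction P rule: finite_induct)
  case empty
  have "{n. n \<in> {1..z} \<and> prime_factors n \<subseteq> {}} \<subseteq> {1::nat}"
    by (auto simp: prime_factorization_empty_iff)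
  then have "(\<Sum>n | n \<in> {1..z} \<and> prime_factors n \<subseteq> {}. 1 / real n) \<le> (\<Sum>n\<in>{1::nat}. 1 / real n)"
    by (intro sum_mono2) auto
  then show ?case by simp
next
  case (insert p P)
  let ?S = "\<lambda>P. {n. n \<in> {1..z} \<and> prime_factors n \<subseteq> P}"
  let ?s = "\<lambda>P. \<Sum>n\<in>?S P. 1 / real n"
  have p: "prime p" "p > 0" "p \<ge> 2" using insert.prems prime_gt_0_nat prime_ge_2_nat by auto
  have sub: "?S (insert p P) \<subseteq> ?S P \<union> (\<lambda>m. p * m) ` ?S (insert p P)"
  proof
    fix n assume n: "n \<in> ?S (insert p P)"
    show "n \<in> ?S P \<union> (\<lambda>m. p * m) ` ?S (insert p P)"
    proof (cases "p dvd n")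
      case True
      then obtain m where m: "n = p * m" by blast
      then have "m \<ge> 1" "m \<le> n" using n p by auto
      moreover have "prime_factors m \<subseteq> prime_factors n"
        using m n by (intro dvd_prime_factors) auto
      ultimately have "m \<in> ?S (insert p P)" using n by auto
      then show ?thesis using m by blast
    next
      case False
      then show ?thesis using n by (auto simp: prime_factors_dvd)
    qed
  qed
  have fin: "finite (?S Q)" for Q by simp
  have "?s (insert p P) \<le> (\<Sum>n\<in>?S P \<union> (\<lambda>m. p * m) ` ?S (insert p P). 1 / real n)"
    by (rule sum_mono2[OF _ sub]) (auto simp: fin)
  also have "\<dots> \<le> ?s P + (\<Sum>n\<in>(\<lambda>m. p * m) ` ?S (insert p P). 1 / real n)"
    by (subst sum_Un) (auto intro!: sum_nonneg simp: fin)
  also have "(\<Sum>n\<in>(\<lambda>m. p * m) ` ?S (insert p P). 1 / real n) = (\<Sum>n\<in>?S (insert p P). 1 / real (p * n))"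
    using p by (subst sum.reindex) (auto simp: inj_on_def)
  also have "\<dots> = ?s (insert p P) / real p"
    by (simp add: sum_divide_distrib mult.commute)
  finally have *: "?s (insert p P) * (1 - 1 / real p) \<le> ?s P" by (simp add: algebra_simps)
  \<comment> \<open>Equality holds at \<open>p = 2\<close>; this is where the factor 2 in the
    exponent comes from.\<close>
  have "1 \<le> (1 - 1 / real p) * (1 + 2 / real p)"
    using p by (simp add: field_simps)
  also have "\<dots> \<le> (1 - 1 / real p) * exp (2 / real p)"
    using p by (intro mult_left_mono exp_ge_add_one_self) auto
  finally have "?s (insert p P) * 1 \<le> ?s (insert p P) * ((1 - 1 / real p) * exp (2 / real p))"
    by (intro mult_left_mono sum_nonneg) auto
  also have "\<dots> = (?s (insert p P) * (1 - 1 / real p)) * exp (2 / real p)" by (simp only: mult.assoc)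
  also have "\<dots> \<le> ?s P * exp (2 / real p)"
    by (intro mult_right_mono *) auto
  also have "\<dots> \<le> exp (2 * (\<Sum>p\<in>P. 1 / real p)) * exp (2 / real p)"
    using insert by (intro mult_right_mono) auto
  also have "\<dots> = exp (2 * (\<Sum>p\<in>insert p P. 1 / real p))"
    using insert by (simp add: exp_add[symmetric] algebra_simps)
  finally show ?case by simp
qed

text \<open>Euler's argument: when all primes up to \<open>z\<close> are allowed, the sum is the
  whole harmonic sum, which is at least \<open>ln z\<close>. The factor 2 only affects the constant
  in the final bound.\<close>

lemma sum_inverse_primes_ge:
  assumes "z \<ge> 2"
  shows "ln (ln (real z)) \<le> 2 * (\<Sum>p | prime p \<and> p \<le> z. 1 / real p)"
proof -
  let ?P = "{p. prime p \<and> p \<le> z}"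
  have fin: "finite ?P" by simp
  have "ln (real z) \<le> ln (real z + 1)" using assms by simp
  also have "\<dots> \<le> harm z" by (rule ln_le_harm)
  also have "\<dots> = (\<Sum>n\<in>{1..z}. 1 / real n)" by (simp add: harm_def inverse_eq_divide)
  also have "{1..z} = {n. n \<in> {1..z} \<and> prime_factors n \<subseteq> ?P}"
    by (auto simp: prime_factors_dvd dest!: dvd_imp_le)
  also have "(\<Sum>n\<in>\<dots>. 1 / real n) \<le> exp (2 * (\<Sum>p\<in>?P. 1 / real p))"
    by (rule smooth_harmonic_sum_le[OF fin]) auto
  finally have "ln (real z) \<le> exp (2 * (\<Sum>p\<in>?P. 1 / real p))" .
  moreover have "ln (real z) > 0" using assms by simp
  ultimately show ?thesis by (metis exp_gt_zero ln_exp ln_le_cancel_iff)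
qed

section \<open>Large divisors\<close>

lemma divisor_sum_eq_abundancy:
  assumes "n > 0" shows "real (divisor_sum n) = real n * abundancy n"
proof -
  have "real n * abundancy n = (\<Sum>d | d dvd n. real n / real d)"
    by (simp add: abundancy_def sum_distrib_left)
  also have "\<dots> = (\<Sum>d | d dvd n. real d)"
    by (rule sum.reindex_bij_witness[of _ "\<lambda>d. n div d" "\<lambda>d. n div d"])
       (use assms in \<open>auto simp: real_of_nat_div dvd_div_eq_0_iff\<close>)
  finally show ?thesis by (simp add: divisor_sum_def)
qed

text \<open>This is the part of the abundancy that is lost when \<open>n\<close> is replaced by
  \<open>gcd n T\<close>.\<close>

definition abundancy_tail :: "nat \<Rightarrow> nat \<Rightarrow> real" where
  "abundancy_tail T n = (\<Sum>d | d dvd n \<and> \<not> d dvd T. 1 / real d)"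

lemma abundancy_split:
  assumes "n > 0"
  shows "abundancy n = abundancy (gcd n T) + abundancy_tail T n"
proof -
  have fin: "finite {d. d dvd n}" using assms by simp
  have eq: "{d. d dvd n} = {d. d dvd gcd n T} \<union> {d. d dvd n \<and> \<not> d dvd T}" by auto
  have "abundancy n = (\<Sum>d\<in>{d. d dvd gcd n T} \<union> {d. d dvd n \<and> \<not> d dvd T}. 1 / real d)"
    unfolding abundancy_def eq[symmetric] ..
  also have "\<dots> = abundancy (gcd n T) + abundancy_tail T n"
    unfolding abundancy_def abundancy_tail_def
    by (rule sum.union_disjoint) (auto intro: finite_subset[OF _ fin])
  finally show ?thesis .
qed

text \<open>Since the abundancy of \<open>gcd n T\<close> is at least 1, an additive tail
  \<open>t\<close> costs at most a factor 1 + t \<le> exp t.\<close>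

lemma ln_abundancy_bounds:
  assumes "n > 0"
  shows "local_log T (int n) \<le> ln (abundancy n)"
    "ln (abundancy n) \<le> local_log T (int n) + abundancy_tail T n"
proof -
  let ?g = "abundancy (gcd n T)"
  have loc: "local_log T (int n) = ln ?g" by (simp add: local_log_def)
  have g: "?g \<ge> 1" using assms by (intro abundancy_ge_1) auto
  have t: "abundancy_tail T n \<ge> 0" by (auto simp: abundancy_tail_def intro: sum_nonneg)
  show "local_log T (int n) \<le> ln (abundancy n)"
    unfolding loc abundancy_split[OF assms, of T] using g t by simp
  have "abundancy n \<le> ?g * (1 + abundancy_tail T n)"
    unfolding abundancy_split[OF assms, of T] using mult_right_mono[OF g t] by (simp add: algebra_simps)
  also have "\<dots> \<le> ?g * exp (abundancy_tail T n)"
    using g by (intro mult_left_mono exp_ge_add_one_self) auto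
  finally have "ln (abundancy n) \<le> ln (?g * exp (abundancy_tail T n))"
    using g abundancy_ge_1[OF assms] by (subst ln_le_cancel_iff) auto
  also have "\<dots> = ln ?g + abundancy_tail T n" using g by (simp add: ln_mult)
  finally show "ln (abundancy n) \<le> local_log T (int n) + abundancy_tail T n" by (simp add: loc)
qed

text \<open>Telescoping with 1 / (N+1)^2 \<le> 1/N - 1/(N+1).\<close>

lemma sum_inverse_squares_le:
  assumes "D \<ge> 1" "N \<ge> D"
  shows "(\<Sum>d\<in>{D<..N}. 1 / (real d)\<^sup>2) \<le> 1 / real D - 1 / real N"
  using assms(2)
proof (induction N rule: dec_induct)
  case base
  then show ?case by simp
next
  case (step N)
  have "{D<..Suc N} = insert (Suc N) {D<..N}" using step by auto
  then have "(\<Sum>d\<in>{D<..Suc N}. 1 / (real d)\<^sup>2) = 1 / (real (Suc N))\<^sup>2 + (\<Sum>d\<in>{D<..N}. 1 / (real d)\<^sup>2)"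
    by simp
  also have "\<dots> \<le> 1 / (real (Suc N))\<^sup>2 + (1 / real D - 1 / real N)" using step by simp
  also have "1 / (real (Suc N))\<^sup>2 \<le> 1 / (real N * real (Suc N))"
    using assms(1) step by (intro divide_left_mono) (auto simp: power2_eq_square)
  also have "1 / (real N * real (Suc N)) = 1 / real N - 1 / real (Suc N)"
    using assms(1) step by (simp add: field_simps)
  finally show ?case by simp
qed

lemma card_multiples_upto:
  "card {n\<in>{1..N}. d dvd n} \<le> N div d" if "d > 0" for d N :: nat
proof -
  have "{n\<in>{1..N}. d dvd n} \<subseteq> (\<lambda>k. d * k) ` {1..N div d}"
  proof
    fix n assume n: "n \<in> {n\<in>{1..N}. d dvd n}"
    then obtain k where "n = d * k" by blast
    then show "n \<in> (\<lambda>k. d * k) ` {1..N div d}"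
      using n that by (auto simp: less_eq_div_iff_mult_less_eq mult.commute Suc_le_eq)
  qed
  then have "card {n\<in>{1..N}. d dvd n} \<le> card ((\<lambda>k. d * k) ` {1..N div d})"
    by (rule card_mono[rotated]) simp
  also have "\<dots> \<le> card {1..N div d}" by (rule card_image_le) simp
  finally show ?thesis by simp
qed

text \<open>Divisors missing from \<open>T\<close> exceed \<open>D\<close>. After exchanging the
  sums, each such \<open>d\<close> has at most \<open>N / d\<close> multiples of weight
  \<open>1 / d\<close>, which leaves the tail of the sum of inverse squares.\<close>

lemma sum_abundancy_tail_le:
  assumes D: "D \<ge> 1" and T: "\<And>d. 1 \<le> d \<Longrightarrow> d \<le> D \<Longrightarrow> d dvd T"
  shows "(\<Sum>n\<in>{1..N}. abundancy_tail T n) \<le> real N / real D"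
proof -
  have "(\<Sum>n\<in>{1..N}. abundancy_tail T n) \<le> (\<Sum>n\<in>{1..N}. \<Sum>d\<in>{D<..N}. if d dvd n then 1 / real d else 0)"
  proof (rule sum_mono)
    fix n assume n: "n \<in> {1..N}"
    have "{d. d dvd n \<and> \<not> d dvd T} \<subseteq> {d\<in>{D<..N}. d dvd n}"
      using T n by (force dest: dvd_imp_le simp: not_le[symmetric] intro: Suc_leI dvd_pos_nat)
    then have "abundancy_tail T n \<le> (\<Sum>d\<in>{d\<in>{D<..N}. d dvd n}. 1 / real d)"
      unfolding abundancy_tail_def by (intro sum_mono2) auto
    also have "\<dots> = (\<Sum>d\<in>{D<..N}. if d dvd n then 1 / real d else 0)"
      by (rule sum.inter_filter) simp
    finally show "abundancy_tail T n \<le> (\<Sum>d\<in>{D<..N}. if d dvd n then 1 / real d else 0)" .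
  qed
  also have "\<dots> = (\<Sum>d\<in>{D<..N}. \<Sum>n\<in>{1..N}. if d dvd n then 1 / real d else 0)"
    by (rule sum.swap)
  also have "\<dots> = (\<Sum>d\<in>{D<..N}. real (card {n\<in>{1..N}. d dvd n}) * (1 / real d))"
    by (intro sum.cong refl) (simp add: sum.If_cases Int_def)
  also have "\<dots> \<le> (\<Sum>d\<in>{D<..N}. real N * (1 / (real d)\<^sup>2))"
  proof (rule sum_mono)
    fix d assume "d \<in> {D<..N}"
    then have "d > 0" by auto
    have "real (card {n\<in>{1..N}. d dvd n}) \<le> real (N div d)"
      using card_multiples_upto[OF \<open>d > 0\<close>] of_nat_mono by blast
    also have "\<dots> \<le> real N / real d" by (rule of_nat_div_le_of_nat)
    finally have "real (card {n\<in>{1..N}. d dvd n}) * (1 / real d) \<le> real N / real d * (1 / real d)"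
      by (rule mult_right_mono) simp
    then show "real (card {n\<in>{1..N}. d dvd n}) * (1 / real d) \<le> real N * (1 / (real d)\<^sup>2)"
      by (simp add: power2_eq_square)
  qed
  also have "\<dots> = real N * (\<Sum>d\<in>{D<..N}. 1 / (real d)\<^sup>2)" by (simp only: sum_distrib_left)
  also have "\<dots> \<le> real N * (1 / real D)"
  proof (rule mult_left_mono)
    show "(\<Sum>d\<in>{D<..N}. 1 / (real d)\<^sup>2) \<le> 1 / real D"
    proof (cases "N \<ge> D")
      case True
      then show ?thesis using sum_inverse_squares_le[OF D True] by (smt (verit) divide_nonneg_nonneg of_nat_0_le_iff)
    qed (use D in auto)
  qed simp
  finally show ?thesis by simp
qed

lemma card_large_tail_le:
  assumes D: "D \<ge> 1" and T: "\<And>d. 1 \<le> d \<Longrightarrow> d \<le> D \<Longrightarrow> d dvd T" and "\<delta> > 0"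
  shows "real (card {n\<in>{1..N}. abundancy_tail T n > \<delta>}) \<le> real N / (real D * \<delta>)"
proof -
  have nonneg: "abundancy_tail T n \<ge> 0" for n by (auto simp: abundancy_tail_def intro: sum_nonneg)
  have "real (card {n\<in>{1..N}. abundancy_tail T n > \<delta>}) * \<delta>
      = (\<Sum>n\<in>{n\<in>{1..N}. abundancy_tail T n > \<delta>}. \<delta>)" by simp
  also have "\<dots> \<le> (\<Sum>n\<in>{n\<in>{1..N}. abundancy_tail T n > \<delta>}. abundancy_tail T n)"
    by (rule sum_mono) auto
  also have "\<dots> \<le> (\<Sum>n\<in>{1..N}. abundancy_tail T n)"
    by (rule sum_mono2) (auto simp: nonneg)
  also have "\<dots> \<le> real N / real D" by (rule sum_abundancy_tail_le[OF D T])
  finally show ?thesis using \<open>\<delta> > 0\<close> D by (simp add: field_simps)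
qed

text \<open>A number is determined by its residue and its quotient modulo \<open>T\<close>; the
  quotients run from 0 to \<open>N div T\<close>, which accounts for the added 1.\<close>

lemma card_residues_le:
  assumes "finite B" "T > 0"
  shows "card {n\<in>{1..N}. int n mod int T \<in> B} \<le> card B * (N div T + 1)"
proof -
  have "card {n\<in>{1..N}. int n mod int T \<in> B} \<le> card (B \<times> {0..N div T})"
  proof (rule card_inj_on_le)
    show "inj_on (\<lambda>n. (int n mod int T, n div T)) {n\<in>{1..N}. int n mod int T \<in> B}"
      by (rule inj_onI) (metis Pair_inject div_mult_mod_eq of_nat_eq_iff of_nat_mod)
    show "(\<lambda>n. (int n mod int T, n div T)) ` {n\<in>{1..N}. int n mod int T \<in> B} \<subseteq> B \<times> {0..N div T}"
      by (auto intro: div_le_mono)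
  qed (use assms in auto)
  then show ?thesis by (simp add: card_cartesian_product)
qed

section \<open>Counting solutions\<close>

text \<open>Take logarithms in the equation. The factor \<open>(n + h) / n\<close> costs at most
  \<open>\<delta>\<close>; the two tails push in opposite directions, so together they cost only one
  more \<open>\<delta>\<close>.\<close>

lemma shift_log_near_ln:
  assumes n: "n \<ge> 1" "int n + h \<ge> 1"
    and eq: "real (divisor_sum (nat (int n + h))) = l * real (divisor_sum n)" and l: "l > 0"
    and z: "z \<ge> 1" and big: "real n \<ge> 16 * real z * \<bar>real_of_int h\<bar>"
    and \<delta>: "\<delta> = 1 / (8 * real z)"
    and t1: "abundancy_tail T n \<le> \<delta>" and t2: "abundancy_tail T (nat (int n + h)) \<le> \<delta>"
  shows "shift_log h T (int n) \<in> {ln l - 2 * \<delta>..ln l + 2 * \<delta>}"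
proof -
  define m where "m = nat (int n + h)"
  have m: "m > 0" "int m = int n + h" "real m = real n + real_of_int h"
    using n by (auto simp: m_def)
  have n0: "n > 0" using n by simp
  have ab: "abundancy n > 0" "abundancy m > 0"
    using abundancy_ge_1[OF n0] abundancy_ge_1[OF m(1)] by auto
  have "real m * abundancy m = l * (real n * abundancy n)"
    using eq divisor_sum_eq_abundancy[OF n0] divisor_sum_eq_abundancy[OF m(1)] by (simp add: m_def)
  then have "ln (real m * abundancy m) = ln (l * (real n * abundancy n))" by simp
  then have main: "ln (real m) + ln (abundancy m) = ln l + ln (real n) + ln (abundancy n)"
    using ab m(1) n0 l by (simp add: ln_mult)
  define y where "y = real_of_int h / real n"
  have "\<bar>y\<bar> * (16 * real z) \<le> 1"
    using big n0 unfolding y_def by (simp add: field_simps abs_divide)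
  then have y: "\<bar>y\<bar> \<le> 1 / (16 * real z)" using z by (simp add: field_simps)
  also have "\<dots> \<le> 1 / 16" using z by (simp add: field_simps)
  finally have y16: "\<bar>y\<bar> \<le> 1 / 16" .
  have "1 + y = real m / real n" using n0 by (simp add: y_def m(3) field_simps)
  then have lny: "ln (1 + y) = ln (real m) - ln (real n)" using n0 m(1) by (simp add: ln_div)
  have "\<bar>ln (1 + y) - y\<bar> \<le> 2 * y\<^sup>2"
    using y16 by (intro abs_ln_one_plus_x_minus_x_bound) auto
  also have "2 * y\<^sup>2 = 2 * \<bar>y\<bar> * \<bar>y\<bar>" by (simp add: power2_eq_square)
  also have "\<dots> \<le> 1 * \<bar>y\<bar>" using y16 by (intro mult_right_mono) auto
  finally have "\<bar>ln (1 + y)\<bar> \<le> 2 * \<bar>y\<bar>" by linarith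
  also have "\<dots> \<le> \<delta>" using y unfolding \<delta> by (simp add: field_simps)
  finally have "\<bar>ln (real m) - ln (real n)\<bar> \<le> \<delta>" by (simp add: lny)
  moreover have "shift_log h T (int n) = local_log T (int m) - local_log T (int n)"
    by (simp add: shift_log_def m(2))
  ultimately show ?thesis
    using main ln_abundancy_bounds[OF n0, of T] ln_abundancy_bounds[OF m(1), of T] t1 t2
    unfolding m_def[symmetric] by auto
qed

text \<open>The summands account for \<open>n\<close> small compared with \<open>h\<close>, for
  large tails at \<open>n\<close> or \<open>n + h\<close> (24 = 8 + 16), and for residues at which
  the periodic function \<open>shift_log h T\<close> lies close to \<open>ln l\<close>.\<close>

lemma A_count_le:
  fixes x l :: real and z :: nat and h :: int
  defines "D \<equiv> z\<^sup>2" and "N \<equiv> nat \<lfloor>x\<rfloor>"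
  defines "J \<equiv> {p. prime p \<and> p \<le> z \<and> \<not> int p dvd h}"
  assumes z: "z \<ge> 1" and l: "l > 0" and TN: "fact D \<le> N" and hN: "nat \<bar>h\<bar> \<le> N"
    and \<mu>: "\<mu> = (\<Sum>p\<in>J. 1 / real p)" "\<mu> > 0"
  shows "real (A_count h l x) \<le> 16 * real z * \<bar>real_of_int h\<bar> + 24 * real N / real z
    + 2 * real N * (sqrt (2 / \<mu>) + 4 / \<mu>)"
proof -
  define T :: nat where "T = fact D"
  define \<delta> where "\<delta> = 1 / (8 * real z)"
  define B where "B = {r\<in>{0..<int T}. shift_log h T r \<in> {ln l - 2 * \<delta>..ln l + 2 * \<delta>}}"
  define K where "K = 16 * z * nat \<bar>h\<bar>"
  \<comment> \<open>Outside the exceptional sets \<open>E1\<close>, \<open>E2\<close>, \<open>E3\<close> a solution \<open>n\<close> has its residue modulo \<open>T\<close> in \<open>B\<close>.\<close>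
  define E1 where "E1 = {1..K}"
  define E2 where "E2 = {n\<in>{1..N}. abundancy_tail T n > \<delta>}"
  define E3 where "E3 = {n\<in>{1..N}. int n + h \<ge> 1 \<and> abundancy_tail T (nat (int n + h)) > \<delta>}"
  define G where "G = {n\<in>{1..N}. int n mod int T \<in> B}"
  have D: "D \<ge> 1" "z \<le> D" using z by (auto simp: D_def power2_eq_square)
  have T: "T > 0" by (simp add: T_def)
  have dT: "d dvd T" if "1 \<le> d" "d \<le> D" for d using that unfolding T_def by (intro dvd_fact)
  have \<delta>0: "\<delta> > 0" using z by (simp add: \<delta>_def)
  \<comment> \<open>With \<open>D = z\<^sup>2\<close> the Markov bound
    \<open>N / (D * \<delta>)\<close> is still of order \<open>N / z\<close> although
    \<open>\<delta>\<close> is of order \<open>1 / z\<close>.\<close>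
  have D\<delta>: "real D * \<delta> = real z / 8" using z by (simp add: D_def \<delta>_def power2_eq_square)
  have finB: "finite B" unfolding B_def by (rule finite_subset[of _ "{0..<int T}"]) auto
  have "A_set h l x \<subseteq> E1 \<union> E2 \<union> E3 \<union> G"
  proof
    fix n assume n: "n \<in> A_set h l x"
    then have n': "n \<ge> 1" "n \<in> {1..N}" "int n + h \<ge> 1"
      "real (divisor_sum (nat (int n + h))) = l * real (divisor_sum n)"
      using A_set_subset[of h l x] by (auto simp: A_set_def N_def)
    show "n \<in> E1 \<union> E2 \<union> E3 \<union> G"
    proof (cases "n \<in> E1 \<union> E2 \<union> E3")
      case False
      then have "K < n" using n' by (auto simp: E1_def)
      then have "real K \<le> real n" by simp
      then have "real n \<ge> 16 * real z * \<bar>real_of_int h\<bar>" by (simp add: K_def)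
      then have "shift_log h T (int n) \<in> {ln l - 2 * \<delta>..ln l + 2 * \<delta>}"
        using False n' by (intro shift_log_near_ln[OF n'(1,3,4) l z _ \<delta>_def]) (auto simp: E2_def E3_def)
      moreover have "shift_log h T (int n) = shift_log h T (int n mod int T)"
        by (rule shift_log_cong) (simp add: cong_def)
      ultimately have "int n mod int T \<in> B" using T by (simp add: B_def)
      then show ?thesis using n' by (simp add: G_def)
    qed simp
  qed
  then have "A_count h l x \<le> card (E1 \<union> E2 \<union> E3 \<union> G)"
    unfolding A_count_def by (rule card_mono[rotated]) (auto simp: E1_def E2_def E3_def G_def)
  also have "\<dots> \<le> card E1 + card E2 + card E3 + card G"
    by (meson add_mono card_Un_le le_refl order_trans)
  finally have "real (A_count h l x) \<le> real (card E1) + real (card E2) + real (card E3) + real (card G)"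
    by linarith
  moreover have "real (card E1) = 16 * real z * \<bar>real_of_int h\<bar>" by (simp add: E1_def K_def)
  moreover have "real (card E2) \<le> 8 * real N / real z"
    using card_large_tail_le[OF D(1) dT \<delta>0, of N] unfolding E2_def D\<delta> by (simp add: mult.commute)
  moreover have "real (card E3) \<le> 16 * real N / real z"
  proof -
    \<comment> \<open>Translation by \<open>h\<close> is injective and may leave
      \<open>{1..N}\<close>, but it stays within \<open>N + nat \<bar>h\<bar>\<close>, at most
      \<open>2 * N\<close>.\<close>
    have "card E3 \<le> card {m\<in>{1..N + nat \<bar>h\<bar>}. abundancy_tail T m > \<delta>}"
    proof (rule card_inj_on_le)
      show "inj_on (\<lambda>n. nat (int n + h)) E3" by (rule inj_onI) (auto simp: E3_def)
      show "(\<lambda>n. nat (int n + h)) ` E3 \<subseteq> {m\<in>{1..N + nat \<bar>h\<bar>}. abundancy_tail T m > \<delta>}"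
        by (auto simp: E3_def)
    qed auto
    then have "real (card E3) \<le> real (card {m\<in>{1..N + nat \<bar>h\<bar>}. abundancy_tail T m > \<delta>})" by simp
    also have "\<dots> \<le> real (N + nat \<bar>h\<bar>) / (real z / 8)"
      using card_large_tail_le[OF D(1) dT \<delta>0, of "N + nat \<bar>h\<bar>"] unfolding D\<delta> by simp
    also have "\<dots> \<le> real (2 * N) / (real z / 8)"
      using hN by (intro divide_right_mono) auto
    finally show ?thesis by (simp add: mult.commute)
  qed
  moreover have "real (card G) \<le> 2 * real N * (sqrt (2 / \<mu>) + 4 / \<mu>)"
  proof -
    have JT: "prime p \<and> p dvd T" if "p \<in> J" for p
      using that D dT[of p] prime_ge_1_nat[of p] by (auto simp: J_def)
    have "real (card B) \<le> (\<Sum>r\<in>{0..<int T}. 1 / sqrt (real (card {p\<in>J. int p dvd r} + 1)))"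
      unfolding B_def
    proof (rule concentration_bound[OF T])
      show "prime p \<and> p dvd T \<and> p \<le> z \<and> \<not> int p dvd h" if "p \<in> J" for p
        using that JT[OF that] by (simp add: J_def)
      \<comment> \<open>The length is \<open>4 * \<delta>\<close>, that is
        \<open>1 / (2 * z)\<close>.\<close>
      show "ln l + 2 * \<delta> - (ln l - 2 * \<delta>) < 2 / (real z + 1)"
        using z by (simp add: \<delta>_def field_simps)
    qed
    also have "\<dots> \<le> real T * (sqrt (2 / \<mu>) + 4 / \<mu>)"
      by (rule average_inverse_sqrt_bound[OF _ JT \<mu>]) (auto simp: J_def)
    finally have B: "real (card B) \<le> real T * (sqrt (2 / \<mu>) + 4 / \<mu>)" .
    have rearrange: "real T * E * real (k + 1) = real (T * k + T) * E" for E k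
      by (simp add: algebra_simps)
    have "real (card G) \<le> real (card B * (N div T + 1))"
      unfolding G_def by (rule of_nat_mono[OF card_residues_le[OF finB T]])
    also have "\<dots> \<le> real T * (sqrt (2 / \<mu>) + 4 / \<mu>) * real (N div T + 1)"
      unfolding of_nat_mult by (rule mult_right_mono[OF B]) simp
    also have "\<dots> = real (T * (N div T) + T) * (sqrt (2 / \<mu>) + 4 / \<mu>)" by (rule rearrange)
    also have "\<dots> \<le> real (2 * N) * (sqrt (2 / \<mu>) + 4 / \<mu>)"
    proof (rule mult_right_mono)
      \<comment> \<open>The incomplete last period costs at most \<open>T\<close>, and
        \<open>T\<close> is at most \<open>N\<close>.\<close>
      have "T * (N div T) + T \<le> 2 * N"
        using TN times_div_less_eq_dividend[of T N] unfolding T_def by linarith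
      then show "real (T * (N div T) + T) \<le> real (2 * N)" by (rule of_nat_mono)
    qed (use \<mu> in auto)
    finally show ?thesis by simp
  qed
  ultimately show ?thesis by (simp add: add_divide_distrib)
qed

section \<open>Choice of the parameters in terms of \<open>x\<close>\<close>

lemma fact_square_le_exp: "fact (z\<^sup>2) \<le> exp (real z ^ 4)"
proof -
  have "(fact (z\<^sup>2) :: real) \<le> real (z\<^sup>2) ^ (z\<^sup>2)"
    using fact_le_power[of "z\<^sup>2", where ?'a = real] by simp
  also have "\<dots> \<le> exp (real (z\<^sup>2)) ^ (z\<^sup>2)"
    using exp_ge_add_one_self[of "real (z\<^sup>2)"] by (intro power_mono) linarith+
  also have "\<dots> = exp (real z ^ 4)"
    by (simp add: exp_of_nat_mult[symmetric] flip: power_add)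
  finally show ?thesis .
qed

text \<open>All asymptotic estimates involve only \<open>x\<close> and \<open>h\<close>, so the
  threshold is uniform in \<open>l\<close>. The constant is 40 = 1 + 1 + 2 * 19 with 19 = 3 +
  16.\<close>

lemma A_count_bound_eventually:
  assumes "h \<noteq> 0"
  shows "eventually (\<lambda>x. \<forall>l>0. real (A_count h l x) \<le> 40 * (x / sqrt (ln (ln (ln x))))) at_top"
proof -
  define c where "c = (\<Sum>p | prime p \<and> int p dvd h. 1 / real p)"
  have finh: "finite {p. prime p \<and> int p dvd h}"
    by (rule finite_subset[of _ "{..nat \<bar>h\<bar>}"]) (use assms in \<open>auto dest!: dvd_imp_le_int\<close>)
  define H where "H = \<bar>real_of_int h\<bar>"
  \<comment> \<open>The exponent 1/8 gives a pure power that lies below \<open>z\<close>, the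
    rounded value of \<open>ln x powr (1/4)\<close>.\<close>
  have ev1: "eventually (\<lambda>x::real. ln x powr (1/4) - 1 \<ge> ln x powr (1/8)) at_top" by real_asymp
  \<comment> \<open>The primes dividing \<open>h\<close> cost only the constant \<open>c\<close>;
    lowering the factor 1/2 to 1/4 absorbs it and keeps \<open>h\<close> out of the final
    constant.\<close>
  have ev2: "eventually (\<lambda>x::real. ln (ln (ln x powr (1/8))) / 2 - c \<ge> ln (ln (ln x)) / 4) at_top"
    by real_asymp
  have ev3: "eventually (\<lambda>x::real. 16 * (ln x powr (1/4)) * H \<le> x / sqrt (ln (ln (ln x)))) at_top"
    by real_asymp
  have ev4: "eventually (\<lambda>x::real. 24 * x / (ln x powr (1/8)) \<le> x / sqrt (ln (ln (ln x)))) at_top"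
    by real_asymp
  have ev5: "eventually (\<lambda>x::real. H \<le> x - 1) at_top" by real_asymp
  have ev6: "eventually (\<lambda>x::real. ln (ln (ln x)) \<ge> 1) at_top" by real_asymp
  have ev7: "eventually (\<lambda>x::real. ln x powr (1/8) \<ge> 2) at_top" by real_asymp
  have ev8: "eventually (\<lambda>x::real. ln x \<ge> 1) at_top" by real_asymp
  show ?thesis
    using ev1 ev2 ev3 ev4 ev5 ev6 ev7 ev8 eventually_ge_at_top[of 1]
  proof eventually_elim
    case (elim x)
    define z where "z = nat \<lfloor>ln x powr (1/4)\<rfloor>"
    define L where "L = ln (ln (ln x))"
    define N where "N = nat \<lfloor>x\<rfloor>"
    have zle: "real z \<le> ln x powr (1/4)" unfolding z_def by (rule of_nat_floor) simp
    have "real z > ln x powr (1/4) - 1" unfolding z_def by linarith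
    with elim have zge: "real z \<ge> ln x powr (1/8)" by linarith
    have z2: "z \<ge> 2" using zge elim by linarith
    have Nle: "real N \<le> x" unfolding N_def using elim by (intro of_nat_floor) simp
    have L1: "L \<ge> 1" using elim by (simp add: L_def)
    let ?J = "{p. prime p \<and> p \<le> z \<and> \<not> int p dvd h}"
    define \<mu> where "\<mu> = (\<Sum>p\<in>?J. 1 / real p)"
    have "ln (ln (ln x powr (1/8))) \<le> ln (ln (real z))"
    proof -
      have gt: "1 < ln x powr (1/8)" using elim by linarith
      show ?thesis
        by (intro ln_mono zge ln_gt_zero gt) (use gt in linarith)
    qed
    also have "\<dots> \<le> 2 * (\<Sum>p | prime p \<and> p \<le> z. 1 / real p)" by (rule sum_inverse_primes_ge[OF z2])
    finally have lnz: "ln (ln (ln x powr (1/8))) \<le> 2 * (\<Sum>p | prime p \<and> p \<le> z. 1 / real p)" .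
    have "(\<Sum>p | prime p \<and> p \<le> z. 1 / real p) \<le> (\<Sum>p\<in>?J \<union> {p. prime p \<and> int p dvd h}. 1 / real p)"
      using finh by (intro sum_mono2) auto
    also have "\<dots> = \<mu> + c"
      unfolding \<mu>_def c_def using finh by (intro sum.union_disjoint) auto
    finally have \<mu>L: "\<mu> \<ge> L / 4" using elim lnz unfolding L_def by linarith
    have \<mu>0: "\<mu> > 0" using \<mu>L L1 by linarith
    have TN: "fact (z\<^sup>2) \<le> N"
    proof -
      have pow4: "(y powr (1/4)) ^ 4 = y" if "y \<ge> 1" for y :: real
        using that by (simp add: powr_power)
      have "real z ^ 4 \<le> (ln x powr (1/4)) ^ 4" using zle by (intro power_mono) auto
      also have "\<dots> = ln x" using elim by (intro pow4)
      finally have "exp (real z ^ 4) \<le> exp (ln x)" by simp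
      then have "real (fact (z\<^sup>2)) \<le> x" using fact_square_le_exp[of z] elim by simp
      then show ?thesis unfolding N_def by (rule le_nat_floor)
    qed
    have hN: "nat \<bar>h\<bar> \<le> N" using elim unfolding N_def H_def by (intro le_nat_floor) simp
    have sL: "sqrt L \<ge> 1" using L1 by simp
    have "1 / L = 1 / sqrt L * (1 / sqrt L)" using L1 by (simp flip: real_sqrt_mult)
    also have "\<dots> \<le> 1 / sqrt L * 1" using sL by (intro mult_left_mono) auto
    finally have invL: "1 / L \<le> 1 / sqrt L" by simp
    \<comment> \<open>The bound \<open>8 / L\<close> for the radicand is rounded up to reach a
      perfect square.\<close>
    have "sqrt (2 / \<mu>) \<le> sqrt (9 / L)"
      using \<mu>L \<mu>0 L1 by (intro real_sqrt_le_mono) (simp add: field_simps)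
    also have "\<dots> = 3 * (1 / sqrt L)"
    proof -
      have "sqrt 9 = (3 :: real)" by (rule real_sqrt_unique) auto
      then show ?thesis by (simp add: real_sqrt_divide)
    qed
    finally have s1: "sqrt (2 / \<mu>) \<le> 3 * (1 / sqrt L)" .
    have "4 / \<mu> \<le> 16 * (1 / L)" using \<mu>L \<mu>0 L1 by (simp add: field_simps)
    also have "\<dots> \<le> 16 * (1 / sqrt L)" using invL by simp
    finally have s: "sqrt (2 / \<mu>) + 4 / \<mu> \<le> 19 * (1 / sqrt L)" using s1 by linarith
    show "\<forall>l>0. real (A_count h l x) \<le> 40 * (x / sqrt (ln (ln (ln x))))"
    proof (intro allI impI)
      fix l :: real assume l: "l > 0"
      have "real (A_count h l x) \<le> 16 * real z * H + 24 * real N / real z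
          + 2 * real N * (sqrt (2 / \<mu>) + 4 / \<mu>)"
        unfolding H_def N_def
        by (rule A_count_le[OF _ l]) (use z2 TN hN \<mu>_def \<mu>0 in \<open>auto simp: N_def\<close>)
      moreover have "16 * real z * H \<le> x / sqrt L"
      proof -
        have "16 * real z * H \<le> 16 * (ln x powr (1/4)) * H"
          using zle by (intro mult_right_mono mult_left_mono) (auto simp: H_def)
        also have "\<dots> \<le> x / sqrt L" using elim by (simp add: L_def)
        finally show ?thesis .
      qed
      moreover have "24 * real N / real z \<le> x / sqrt L"
      proof -
        have "24 * real N / real z \<le> 24 * x / (ln x powr (1/8))"
          using zge Nle elim by (intro frac_le mult_left_mono) auto
        also have "\<dots> \<le> x / sqrt L" using elim by (simp add: L_def)
        finally show ?thesis .
      qed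
      moreover have "2 * real N * (sqrt (2 / \<mu>) + 4 / \<mu>) \<le> 2 * x * (19 * (1 / sqrt L))"
        using Nle s elim \<mu>0 by (intro mult_mono) auto
      ultimately show "real (A_count h l x) \<le> 40 * (x / sqrt (ln (ln (ln x))))"
        unfolding L_def[symmetric] by simp
    qed
  qed
qed

theorem theorem4p1:
  shows "(\<exists>C::real. C > 0 \<and> (\<forall>h::int. h \<noteq> 0 \<longrightarrow>
            (\<exists>x0::real. \<forall>x::real. x \<ge> x0 \<longrightarrow>
               (SUP l\<in>{0::real<..}. real (A_count h l x)) \<le> C * (x / sqrt (ln (ln (ln x)))))))
       \<and> (\<forall>h::int. h \<noteq> 0 \<longrightarrow>
            ((\<lambda>x::real. SUP l\<in>{0::real<..}. real (A_count h l x) / x) \<longlongrightarrow> 0) at_top)"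
proof (rule conjI, rule exI[of _ 40], rule conjI[OF _ allI[OF impI]])
  show "0 < (40::real)" by simp
next
  fix h :: int assume h: "h \<noteq> 0"
  obtain x0 where "\<And>x l. x \<ge> x0 \<Longrightarrow> l > 0 \<Longrightarrow> real (A_count h l x) \<le> 40 * (x / sqrt (ln (ln (ln x))))"
    using A_count_bound_eventually[OF h] by (auto simp: eventually_at_top_linorder)
  then show "\<exists>x0. \<forall>x\<ge>x0. (SUP l\<in>{0<..}. real (A_count h l x)) \<le> 40 * (x / sqrt (ln (ln (ln x))))"
    by (intro exI[of _ x0] allI impI cSUP_least) auto
next
  show "\<forall>h. h \<noteq> 0 \<longrightarrow> ((\<lambda>x. SUP l\<in>{0<..}. real (A_count h l x) / x) \<longlongrightarrow> 0) at_top"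
  proof (intro allI impI)
    fix h :: int assume h: "h \<noteq> 0"
    show "((\<lambda>x. SUP l\<in>{0<..}. real (A_count h l x) / x) \<longlongrightarrow> 0) at_top"
    proof (rule tendsto_sandwich)
      show "((\<lambda>x::real. 0::real) \<longlongrightarrow> 0) at_top" by simp
      show "((\<lambda>x::real. 40 / sqrt (ln (ln (ln x)))) \<longlongrightarrow> 0) at_top" by real_asymp
      show "eventually (\<lambda>x. (SUP l\<in>{0<..}. real (A_count h l x) / x) \<le> 40 / sqrt (ln (ln (ln x)))) at_top"
        using A_count_bound_eventually[OF h] eventually_gt_at_top[of 0]
      proof eventually_elim
        case (elim x)
        show ?case
        proof (rule cSUP_least)
          fix l :: real assume "l \<in> {0<..}"
          then show "real (A_count h l x) / x \<le> 40 / sqrt (ln (ln (ln x)))"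
            using elim by (simp add: pos_divide_le_eq)
        qed simp
      qed
      show "eventually (\<lambda>x. 0 \<le> (SUP l\<in>{0<..}. real (A_count h l x) / x)) at_top"
        using eventually_gt_at_top[of 0]
      proof eventually_elim
        case (elim x)
        \<comment> \<open>A lower bound for a real \<open>SUP\<close> requires the set to be bounded
          above; the value at \<open>l = 1\<close> then witnesses nonnegativity.\<close>
        obtain M where M: "\<And>l. l > 0 \<Longrightarrow> real (A_count h l x) \<le> M"
          using bdd_above_A_count[of h x] by (auto simp: bdd_above_def)
        have "bdd_above ((\<lambda>l. real (A_count h l x) / x) ` {0<..})"
          by (rule bdd_aboveI2[of _ _ "M / x"]) (use M elim in \<open>auto intro: divide_right_mono\<close>)
        then have "real (A_count h 1 x) / x \<le> (SUP l\<in>{0<..}. real (A_count h l x) / x)"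
          by (intro cSUP_upper) auto
        moreover have "0 \<le> real (A_count h 1 x) / x" using elim by simp
        ultimately show ?case by linarith
      qed
    qed
  qed
qed

end
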